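(* Let $Y$ be a Banach space. For any $N\in\mathbb{N}$, the following are equivalent. (a) The norm of $Y$ is strongly subdifferentiable. (b) Given $\varepsilon>0$, a nonempty set $A\subset\{1,\ldots,N\}$, $(\alpha_j)_{j\in A}$ with $\alpha_j>0$ for all $j\in A$ and $\sum_{j\in A}\alpha_j=1$, and $y\in S_Y$, there is $\eta=\eta(\varepsilon,(\alpha_j)_{j\in A},y)>0$ such that whenever $(y_j^* )_{j\in A}\subset S_{Y^*}$ satisfies $$\operatorname{Re}\sum_{j\in A}\alpha_j y_j^*(y)>1-\eta,$$ there is $(z_j^* )_{j\in A}\subset S_{Y^*}$ such that $z_j^*(y)=1$ and $\|z_j^*-y_j^*\|<\varepsilon$ for all $j\in A$.
   Context: Banach spaces are over $\mathbb{K}=\mathbb{R}$ or $\mathbb{C}$. $S_Y$, $B_Y$, $Y^*$ denote the unit sphere, the closed unit ball and the topological dual of $Y$. The norm of $Y$ is strongly subdifferentiable (SSD) if for every $y\in S_Y$ the one-sided limit $\lim_{t\to0^+}\frac{\|y+th\|-\|y\|}{t}$ exists uniformly for $h\in B_Y$. *)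

theory Defs
  imports "HOL-Analysis.Analysis"
begin

(* A Banach space is a type of class banach, which provides its real structure.  A scalar
   multiplication scl over a field 'k (complex numbers, in the case of a complex Banach space) is
   required to extend the real one and to satisfy the norm axiom. *)
locale normed_space_over = vector_space scl
  for scl :: "'k::real_normed_field \<Rightarrow> 'a::real_normed_vector \<Rightarrow> 'a" +
  assumes scale_of_real: "scl (of_real r) x = r *\<^sub>R x"
    and norm_scale: "norm (scl c x) = norm c * norm x"

lemma normed_space_over_scaleR:
  "normed_space_over (scaleR :: real \<Rightarrow> 'a::real_normed_vector \<Rightarrow> 'a)"
  by unfold_locales (simp_all add: algebra_simps)

lemma normed_space_over_times:
  "normed_space_over ((*) :: complex \<Rightarrow> complex \<Rightarrow> complex)"
  by unfold_locales (simp_all add: algebra_simps scaleR_conv_of_real norm_mult)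

(* The bounded functionals that are linear over 'k.  Elements of the blinfun type are only
   real-linear; the blinfun norm is the usual operator norm. *)
definition dual_space ::
    "('k::real_normed_field \<Rightarrow> 'a::real_normed_vector \<Rightarrow> 'a) \<Rightarrow> ('a \<Rightarrow>\<^sub>L 'k) set" where
  "dual_space scl =
     {f. \<forall>c x. blinfun_apply f (scl c x) = c * blinfun_apply f x}"

definition dual_sphere ::
    "('k::real_normed_field \<Rightarrow> 'a::real_normed_vector \<Rightarrow> 'a) \<Rightarrow> ('a \<Rightarrow>\<^sub>L 'k) set" where
  "dual_sphere scl = {f \<in> dual_space scl. norm f = 1}"

definition strongly_subdifferentiable_norm :: "'a::real_normed_vector itself \<Rightarrow> bool" where
  "strongly_subdifferentiable_norm _ \<longleftrightarrow>
     (\<forall>y \<in> sphere (0::'a) 1. \<exists>d :: 'a \<Rightarrow> real.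
        uniform_limit (cball 0 1) (\<lambda>t h. (norm (y + t *\<^sub>R h) - norm y) / t) d (at_right 0))"

(* re is the real part on the scalar field: the identity for real scalars, Re for complex ones. *)
definition convex_combination_correction ::
    "('k::real_normed_field \<Rightarrow> 'a::real_normed_vector \<Rightarrow> 'a) \<Rightarrow> ('k \<Rightarrow> real) \<Rightarrow> nat \<Rightarrow> bool" where
  "convex_combination_correction scl re N \<longleftrightarrow>
     (\<forall>\<epsilon>>0. \<forall>A \<alpha>. \<forall>y \<in> sphere (0::'a) 1.
        A \<subseteq> {1..N} \<and> A \<noteq> {} \<and> (\<forall>j\<in>A. \<alpha> j > (0::real)) \<and> (\<Sum>j\<in>A. \<alpha> j) = 1 \<longrightarrow>
        (\<exists>\<eta>>0. \<forall>y' :: nat \<Rightarrow> 'a \<Rightarrow>\<^sub>L 'k.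
           (\<forall>j\<in>A. y' j \<in> dual_sphere scl) \<and>
           re (\<Sum>j\<in>A. \<alpha> j *\<^sub>R blinfun_apply (y' j) y) > 1 - \<eta> \<longrightarrow>
           (\<exists>z' :: nat \<Rightarrow> 'a \<Rightarrow>\<^sub>L 'k.
              \<forall>j\<in>A. z' j \<in> dual_sphere scl \<and> blinfun_apply (z' j) y = 1 \<and>
                norm (z' j - y' j) < \<epsilon>)))"

end

(* The norm is strongly subdifferentiable at y exactly when every norm-one functional f that almost
   attains its norm at y is close to a norm-one functional attaining it there; convex combinations
   add nothing, since each term of an almost extremal combination is itself almost extremal.
   If functionals can be corrected, the difference quotient at step t in direction h is at most
   Re f h for f norming y + t h, and correcting f shows that this exceeds the limit by at most
   epsilon, uniformly in h.  Conversely, uniformity gives Re f <= D + c |.|, where D is the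
   directional derivative of the norm at y, and a Hahn-Banach sandwich between Re f - c |.| and
   the sublinear D yields a functional attaining its norm at y within c of f. *)

theory Submission
  imports Defs
begin

section \<open>The Mazur--Orlicz theorem\<close>

definition sublinear :: "('a::real_vector \<Rightarrow> real) \<Rightarrow> bool" where
  "sublinear p \<longleftrightarrow>
     (\<forall>x y. p (x + y) \<le> p x + p y) \<and> (\<forall>r\<ge>0. \<forall>x. p (r *\<^sub>R x) = r * p x)"

lemma sublinear_add: "sublinear p \<Longrightarrow> p (x + y) \<le> p x + p y"
  by (simp add: sublinear_def)

lemma sublinear_scaleR: "sublinear p \<Longrightarrow> 0 \<le> r \<Longrightarrow> p (r *\<^sub>R x) = r * p x"
  by (simp add: sublinear_def)

lemma sublinear_zero: "sublinear p \<Longrightarrow> p 0 = 0"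
  using sublinear_scaleR[of p 0 0] by simp

lemma sublinear_minus: "sublinear p \<Longrightarrow> - p (- x) \<le> p x"
  using sublinear_add[of p x "- x"] by (simp add: sublinear_zero)

text \<open>Applying \<open>scale\<close> to \<open>inverse r\<close> and
  \<open>r *\<^sub>R x\<close> gives the reverse inequality, hence full positive
  homogeneity.\<close>

lemma sublinearI:
  assumes add: "\<And>x y. p (x + y) \<le> p x + p y"
    and scale: "\<And>r x. 0 < r \<Longrightarrow> p (r *\<^sub>R x) \<le> r * p x"
    and zero: "p 0 = 0"
  shows "sublinear p"
  unfolding sublinear_def
proof (intro conjI allI impI)
  fix r :: real and x assume "0 \<le> r"
  show "p (r *\<^sub>R x) = r * p x"
  proof (cases "r = 0")
    case False
    with \<open>0 \<le> r\<close> have "0 < r" by simp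
    have "p x \<le> inverse r * p (r *\<^sub>R x)"
      using scale[of "inverse r" "r *\<^sub>R x"] \<open>0 < r\<close> by simp
    then have "r * p x \<le> p (r *\<^sub>R x)"
      using \<open>0 < r\<close> by (simp add: field_simps)
    with scale[OF \<open>0 < r\<close>, of x] show ?thesis by simp
  qed (simp add: zero)
qed (rule add)

lemma sublinear_norm: "sublinear (norm :: 'a::real_normed_vector \<Rightarrow> real)"
  by (simp add: sublinear_def norm_triangle_ineq)

text \<open>Convexity: \<open>y + s *\<^sub>R h\<close> is a convex combination of \<open>y\<close>
  and \<open>y + t *\<^sub>R h\<close>, here multiplied by \<open>t\<close> to avoid
  fractions.\<close>

lemma norm_difference_quotient_mono:
  fixes y h :: "'a::real_normed_vector"
  assumes "0 < s" "s \<le> t"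
  shows "(norm (y + s *\<^sub>R h) - norm y) / s \<le> (norm (y + t *\<^sub>R h) - norm y) / t"
proof -
  have "t * norm (y + s *\<^sub>R h) = norm (t *\<^sub>R (y + s *\<^sub>R h))"
    using assms by simp
  also have "t *\<^sub>R (y + s *\<^sub>R h) = (t - s) *\<^sub>R y + s *\<^sub>R (y + t *\<^sub>R h)"
    by (simp add: algebra_simps)
  also have "norm \<dots> \<le> norm ((t - s) *\<^sub>R y) + norm (s *\<^sub>R (y + t *\<^sub>R h))"
    by (rule norm_triangle_ineq)
  also have "\<dots> = (t - s) * norm y + s * norm (y + t *\<^sub>R h)"
    using assms by simp
  finally show ?thesis using assms by (simp add: field_simps)
qed

section \<open>Envelopes of sublinear functionals over convex cones\<close>

lemma le_cINF_add_cINF: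
  fixes f :: "'a \<Rightarrow> real" and g :: "'b \<Rightarrow> real"
  assumes "A \<noteq> {}" "B \<noteq> {}" and le: "\<And>a b. a \<in> A \<Longrightarrow> b \<in> B \<Longrightarrow> l \<le> f a + g b"
  shows "l \<le> (INF a\<in>A. f a) + (INF b\<in>B. g b)"
proof -
  have "l - f a \<le> (INF b\<in>B. g b)" if "a \<in> A" for a
    using le[OF that] by (intro cINF_greatest \<open>B \<noteq> {}\<close>) (simp add: algebra_simps)
  then have "l - (INF b\<in>B. g b) \<le> (INF a\<in>A. f a)"
    by (intro cINF_greatest \<open>A \<noteq> {}\<close>) (simp add: algebra_simps)
  then show ?thesis by simp
qed

text \<open>Under the hypotheses of \<open>sublinear_over_cone\<close>, a linear functional lies
  below the envelope exactly when it lies below \<open>q\<close> everywhere and above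
  \<open>g\<close> on \<open>C\<close>. Two constraints thus become one.\<close>

definition envelope ::
    "('a::real_vector \<Rightarrow> real) \<Rightarrow> 'a set \<Rightarrow> ('a \<Rightarrow> real) \<Rightarrow> 'a \<Rightarrow> real" where
  "envelope q C g x = (INF c\<in>C. q (x + c) - g c)"

text \<open>It is used with \<open>C\<close> a ray and \<open>g = q\<close>, and with
  \<open>C\<close> the whole space and \<open>g\<close> a concave functional.\<close>

locale sublinear_over_cone =
  fixes q g :: "'a::real_vector \<Rightarrow> real" and C :: "'a set"
  assumes sublinear: "sublinear q"
    and cone: "convex_cone C"
    and superadditive: "\<And>x y. x \<in> C \<Longrightarrow> y \<in> C \<Longrightarrow> g x + g y \<le> g (x + y)"
    and homogeneous: "\<And>r x. 0 \<le> r \<Longrightarrow> x \<in> C \<Longrightarrow> g (r *\<^sub>R x) = r * g x"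
    and le: "\<And>x. x \<in> C \<Longrightarrow> g x \<le> q x"
begin

lemma zero_mem: "0 \<in> C"
  using cone by (simp add: convex_cone_iff)

lemma cone_nonempty: "C \<noteq> {}"
  using zero_mem by blast

lemma g_zero: "g 0 = 0"
  using homogeneous[OF order_refl zero_mem] by simp

text \<open>Bounds the terms of the envelope from below, so that the real \<open>INF\<close> is a
  genuine infimum.\<close>

lemma lower_bound:
  assumes "c \<in> C"
  shows "- q (- x) \<le> q (x + c) - g c"
proof -
  have "g c \<le> q ((x + c) + (- x))" using le[OF assms] by simp
  also have "\<dots> \<le> q (x + c) + q (- x)" by (rule sublinear_add[OF sublinear])
  finally show ?thesis by simp
qed

lemma envelope_lower:
  assumes "c \<in> C"
  shows "envelope q C g x \<le> q (x + c) - g c"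
  unfolding envelope_def
  by (rule cINF_lower) (use assms lower_bound in \<open>auto intro!: bdd_belowI2[where m = "- q (- x)"]\<close>)

lemma envelope_le: "envelope q C g x \<le> q x"
  using envelope_lower[OF zero_mem, of x] by (simp add: g_zero)

text \<open>Cone elements \<open>a\<close> for \<open>x\<close> and \<open>b\<close> for
  \<open>y\<close> yield the competitor \<open>a + b\<close> for \<open>x + y\<close>, and
  \<open>r *\<^sub>R c\<close> competes for \<open>r *\<^sub>R x\<close>. At 0, nonnegativity is the
  bound of \<open>g\<close> by \<open>q\<close> on the cone.\<close>

lemma sublinear_envelope: "sublinear (envelope q C g)"
proof (rule sublinearI)
  fix x y
  show "envelope q C g (x + y) \<le> envelope q C g x + envelope q C g y"
    unfolding envelope_def[of _ _ _ x] envelope_def[of _ _ _ y]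
  proof (rule le_cINF_add_cINF)
    fix a b assume ab: "a \<in> C" "b \<in> C"
    then have "envelope q C g (x + y) \<le> q ((x + y) + (a + b)) - g (a + b)"
      by (intro envelope_lower convex_cone_add[OF cone])
    also have "q ((x + y) + (a + b)) = q ((x + a) + (y + b))"
      by (simp add: algebra_simps)
    also have "\<dots> \<le> q (x + a) + q (y + b)"
      by (rule sublinear_add[OF sublinear])
    finally show "envelope q C g (x + y) \<le> (q (x + a) - g a) + (q (y + b) - g b)"
      using superadditive[OF ab] by linarith
  qed (use cone_nonempty in auto)
next
  fix r :: real and x assume r: "0 < r"
  have "envelope q C g (r *\<^sub>R x) / r \<le> envelope q C g x"
    unfolding envelope_def[of _ _ _ x]
  proof (rule cINF_greatest[OF cone_nonempty])
    fix c assume c: "c \<in> C"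
    have "envelope q C g (r *\<^sub>R x) \<le> q (r *\<^sub>R x + r *\<^sub>R c) - g (r *\<^sub>R c)"
      using r c by (intro envelope_lower convex_cone_scaleR[OF cone]) auto
    also have "\<dots> = r * (q (x + c) - g c)"
      using r c sublinear_scaleR[OF sublinear, of r "x + c"]
      by (simp add: homogeneous algebra_simps)
    finally show "envelope q C g (r *\<^sub>R x) / r \<le> q (x + c) - g c"
      using r by (simp add: field_simps)
  qed
  then show "envelope q C g (r *\<^sub>R x) \<le> r * envelope q C g x"
    using r by (simp add: field_simps)
next
  have "0 \<le> envelope q C g 0"
    unfolding envelope_def
    by (rule cINF_greatest[OF cone_nonempty]) (simp add: le)
  with envelope_le[of 0] show "envelope q C g 0 = 0"
    by (simp add: sublinear_zero[OF sublinear])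
qed

end

section \<open>Rays, and linear functionals below sublinear ones\<close>

lemma convex_cone_ray: "convex_cone ((\<lambda>s. s *\<^sub>R a) ` {0::real..})"
  unfolding convex_cone_iff
proof (intro conjI ballI allI impI)
  show "0 \<in> (\<lambda>s. s *\<^sub>R a) ` {0::real..}"
    by (rule image_eqI[of _ _ 0]) auto
  show "x + y \<in> (\<lambda>s. s *\<^sub>R a) ` {0::real..}"
    if "x \<in> (\<lambda>s. s *\<^sub>R a) ` {0..}" "y \<in> (\<lambda>s. s *\<^sub>R a) ` {0..}" for x y
    using that by (auto simp flip: scaleR_add_left)
  show "r *\<^sub>R x \<in> (\<lambda>s. s *\<^sub>R a) ` {0::real..}"
    if "x \<in> (\<lambda>s. s *\<^sub>R a) ` {0..}" "0 \<le> r" for x and r :: real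
    using that by auto
qed

text \<open>By homogeneity \<open>q\<close> is additive along a ray, so there it can serve as its
  own lower bound.\<close>

lemma sublinear_over_ray:
  assumes "sublinear q"
  shows "sublinear_over_cone q q ((\<lambda>s. s *\<^sub>R a) ` {0::real..})"
proof
  show "q x + q y \<le> q (x + y)"
    if "x \<in> (\<lambda>s. s *\<^sub>R a) ` {0::real..}" "y \<in> (\<lambda>s. s *\<^sub>R a) ` {0..}" for x y
    using that assms by (auto simp: sublinear_scaleR algebra_simps simp flip: scaleR_add_left)
qed (use assms convex_cone_ray in \<open>auto simp: sublinear_scaleR simp del: scaleR_scaleR\<close>)

text \<open>Lowering \<open>q\<close> along the ray through \<open>a\<close> cannot change it, and
  the term of the envelope at \<open>a\<close> then reads \<open>q x \<le> q (x + a) - q a\<close>.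
  So \<open>q\<close> is also superadditive.\<close>

lemma minimal_sublinear_linear:
  assumes q: "sublinear q"
    and minimal: "\<And>p. sublinear p \<Longrightarrow> p \<le> q \<Longrightarrow> p = q"
  shows "linear q"
proof -
  have ge: "q x + q a \<le> q (x + a)" for x a
  proof -
    interpret sublinear_over_cone q q "(\<lambda>s. s *\<^sub>R a) ` {0..}"
      using q by (rule sublinear_over_ray)
    have "envelope q ((\<lambda>s. s *\<^sub>R a) ` {0..}) q = q"
      by (rule minimal[OF sublinear_envelope le_funI[OF envelope_le]])
    moreover have "a \<in> (\<lambda>s. s *\<^sub>R a) ` {0::real..}"
      by (rule image_eqI[of _ _ 1]) auto
    ultimately show ?thesis
      using envelope_lower[of a x] by simp
  qed
  have add: "q (x + y) = q x + q y" for x y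
    using ge[of x y] sublinear_add[OF q, of x y] by simp
  have minus: "q (- x) = - q x" for x
    using add[of x "- x"] sublinear_zero[OF q] by simp
  have "q (r *\<^sub>R x) = r * q x" for r x
  proof (cases "0 \<le> r")
    case False
    then have "q (- ((- r) *\<^sub>R x)) = r * q x"
      unfolding minus by (simp add: sublinear_scaleR[OF q, of "- r"] del: scaleR_minus_left)
    then show ?thesis by simp
  qed (rule sublinear_scaleR[OF q])
  with add show ?thesis by (intro linearI) auto
qed

text \<open>Prepares Zorn's lemma. Subadditivity uses the chain: for two members, the smaller one
  can replace both.\<close>

lemma sublinear_INF_chain:
  assumes "K \<noteq> {}" and sub: "\<And>q. q \<in> K \<Longrightarrow> sublinear q"
    and bound: "\<And>q. q \<in> K \<Longrightarrow> q \<le> p"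
    and chain: "\<And>q r. q \<in> K \<Longrightarrow> r \<in> K \<Longrightarrow> q \<le> r \<or> r \<le> q"
  shows "sublinear (\<lambda>x. INF q\<in>K. q x)" and "q \<in> K \<Longrightarrow> (INF q\<in>K. q x) \<le> q x"
proof -
  have lower: "(INF q\<in>K. q x) \<le> q x" if "q \<in> K" for q x
  proof (rule cINF_lower[OF _ that])
    show "bdd_below ((\<lambda>q. q x) ` K)"
    proof (rule bdd_belowI2)
      fix q assume "q \<in> K"
      \<comment> \<open>From \<open>- p (- x) \<le> - q (- x) \<le> q x\<close>, a bound independent
        of \<open>q\<close>.\<close>
      then show "- p (- x) \<le> q x"
        using sublinear_minus[OF sub, of q x] le_funD[OF bound, of q "- x"] by fastforce
    qed
  qed
  show "q \<in> K \<Longrightarrow> (INF q\<in>K. q x) \<le> q x"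
    by (rule lower)
  show "sublinear (\<lambda>x. INF q\<in>K. q x)"
  proof (rule sublinearI)
    fix x y
    show "(INF q\<in>K. q (x + y)) \<le> (INF q\<in>K. q x) + (INF q\<in>K. q y)"
    proof (rule le_cINF_add_cINF[OF \<open>K \<noteq> {}\<close> \<open>K \<noteq> {}\<close>])
      fix a b assume ab: "a \<in> K" "b \<in> K"
      obtain c where c: "c \<in> K" "c \<le> a" "c \<le> b"
        using chain[OF ab] ab by blast
      have "(INF q\<in>K. q (x + y)) \<le> c (x + y)" by (rule lower[OF c(1)])
      also have "\<dots> \<le> c x + c y" by (rule sublinear_add[OF sub[OF c(1)]])
      also have "\<dots> \<le> a x + b y" using c by (intro add_mono) (auto simp: le_fun_def)
      finally show "(INF q\<in>K. q (x + y)) \<le> a x + b y" .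
    qed
  next
    fix r :: real and x assume r: "0 < r"
    have "(INF q\<in>K. q (r *\<^sub>R x)) / r \<le> (INF q\<in>K. q x)"
    proof (rule cINF_greatest[OF \<open>K \<noteq> {}\<close>])
      fix q assume "q \<in> K"
      then have "(INF q\<in>K. q (r *\<^sub>R x)) \<le> r * q x"
        using lower[of q "r *\<^sub>R x"] r by (simp add: sublinear_scaleR[OF sub])
      then show "(INF q\<in>K. q (r *\<^sub>R x)) / r \<le> q x"
        using r by (simp add: field_simps)
    qed
    then show "(INF q\<in>K. q (r *\<^sub>R x)) \<le> r * (INF q\<in>K. q x)"
      using r by (simp add: field_simps)
  next
    have "(INF q\<in>K. q (0::'a)) = (INF q\<in>K. 0)"
      using sub by (intro INF_cong) (auto simp: sublinear_zero)
    also have "\<dots> = 0" using \<open>K \<noteq> {}\<close> by simp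
    finally show "(INF q\<in>K. q (0::'a)) = 0" .
  qed
qed

text \<open>Hahn-Banach: Zorn's lemma supplies a minimal sublinear functional below
  \<open>p\<close>, and such a functional is linear.\<close>

lemma linear_below_sublinear:
  assumes p: "sublinear p"
  shows "\<exists>f. linear f \<and> (\<forall>x. f x \<le> p x)"
proof -
  let ?A = "{q. sublinear q \<and> q \<le> p}"
  have "\<exists>m\<in>?A. \<forall>q\<in>?A. q \<le> m \<longrightarrow> q = m"
  \<comment> \<open>The order is reversed, so that maximal elements are minimal functionals; the
    empty chain is bounded by \<open>p\<close>.\<close>
  proof (rule predicate_Zorn)
    show "partial_order_on ?A (relation_of (\<lambda>q r. r \<le> q) ?A)"
      by (rule partial_order_on_relation_ofI) auto
    fix K assume "K \<in> Chains (relation_of (\<lambda>q r. r \<le> q) ?A)"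
    then have sub: "\<And>q. q \<in> K \<Longrightarrow> sublinear q" and bound: "\<And>q. q \<in> K \<Longrightarrow> q \<le> p"
      and chain: "\<And>q r. q \<in> K \<Longrightarrow> r \<in> K \<Longrightarrow> q \<le> r \<or> r \<le> q"
      by (auto simp: Chains_def relation_of_def le_fun_def)
    show "\<exists>u\<in>?A. \<forall>q\<in>K. u \<le> q"
    proof (cases "K = {}")
      case False
      note inf = sublinear_INF_chain[OF False sub bound chain]
      obtain q where "q \<in> K" using False by blast
      then have "(\<lambda>x. INF q\<in>K. q x) \<le> p"
        using inf(2) bound unfolding le_fun_def by (meson order_trans)
      with inf show ?thesis
        by (intro bexI[of _ "\<lambda>x. INF q\<in>K. q x"]) (auto simp: le_fun_def)
    qed (use p in auto)
  qed
  then obtain m where m: "sublinear m" "m \<le> p"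
      and minimal: "\<And>q. sublinear q \<Longrightarrow> q \<le> p \<Longrightarrow> q \<le> m \<Longrightarrow> q = m"
    by blast
  have "linear m"
    using m minimal by (intro minimal_sublinear_linear) (blast intro: order_trans)+
  with m(2) show ?thesis by (auto simp: le_fun_def)
qed

theorem (in sublinear_over_cone) mazur_orlicz:
  obtains f where "linear f" "\<And>x. f x \<le> q x" "\<And>x. x \<in> C \<Longrightarrow> g x \<le> f x"
proof -
  obtain f where f: "linear f" "\<And>x. f x \<le> envelope q C g x"
    using linear_below_sublinear[OF sublinear_envelope] by blast
  show thesis
  proof
    show "linear f" by fact
    show "f x \<le> q x" for x
      using f(2) envelope_le order_trans by blast
    show "g x \<le> f x" if "x \<in> C" for x
    proof -
      \<comment> \<open>At the point \<open>- x\<close>, the cone element \<open>x\<close> makes the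
        argument of \<open>q\<close> zero.\<close>
      have "- f x = f (- x)" by (simp add: linear_neg[OF f(1)])
      also have "\<dots> \<le> q (- x + x) - g x"
        using f(2) envelope_lower[OF that] order_trans by blast
      finally show ?thesis by (simp add: sublinear_zero[OF sublinear])
    qed
  qed
qed

section \<open>Functionals over the scalar field\<close>

text \<open>Collects what the argument needs from the field, so that real and complex scalars are
  treated together. \<open>rotate\<close> passes bounds from real parts to functionals;
  \<open>extend\<close> recovers a functional from its real part.\<close>

locale scalar_real_part = normed_space_over scl
  for scl :: "'k::real_normed_field \<Rightarrow> 'a::real_normed_vector \<Rightarrow> 'a" +
  fixes re :: "'k \<Rightarrow> real"
  assumes linear_re: "linear re"
    and re_le_norm: "re c \<le> norm c"
    and re_of_real: "re (of_real r) = r"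
    and re_eq_one: "norm c \<le> 1 \<Longrightarrow> re c = 1 \<Longrightarrow> c = 1"
    and rotate: "\<exists>u. norm u = 1 \<and> u * c = of_real (norm c)"
    and extend: "bounded_linear z \<Longrightarrow> \<exists>f \<in> dual_space scl. \<forall>x. re (blinfun_apply f x) = z x"
begin

lemma dual_space_diff: "f \<in> dual_space scl \<Longrightarrow> g \<in> dual_space scl \<Longrightarrow> f - g \<in> dual_space scl"
  by (simp add: dual_space_def blinfun.diff_left algebra_simps)

text \<open>Multiplying \<open>x\<close> by a scalar of modulus one turns the value of
  \<open>f\<close> into its modulus, without changing the norm of \<open>x\<close>.\<close>

lemma norm_le_of_re_le:
  assumes f: "f \<in> dual_space scl" and "0 \<le> b"
    and le: "\<And>x. re (blinfun_apply f x) \<le> b * norm x"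
  shows "norm f \<le> b"
proof (rule norm_blinfun_bound[OF \<open>0 \<le> b\<close>])
  fix x
  obtain u where u: "norm u = 1" "u * blinfun_apply f x = of_real (norm (blinfun_apply f x))"
    using rotate by blast
  have "norm (blinfun_apply f x) = re (blinfun_apply f (scl u x))"
    using f u(2) by (simp add: dual_space_def re_of_real)
  also have "\<dots> \<le> b * norm (scl u x)" by (rule le)
  finally show "norm (blinfun_apply f x) \<le> b * norm x"
    by (simp add: norm_scale u(1))
qed

lemma re_apply_le: "re (blinfun_apply f x) \<le> norm f * norm x"
  using re_le_norm norm_blinfun order_trans by blast

lemma linear_re_apply: "linear (\<lambda>x. re (blinfun_apply f x))"
  using linear_compose[OF bounded_linear.linear[OF blinfun.bounded_linear_right] linear_re]
  by (simp add: comp_def)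

lemma extend_bound:
  assumes z: "linear z" and le: "\<And>x. z x \<le> norm x"
  obtains f where "f \<in> dual_space scl" "\<And>x. re (blinfun_apply f x) = z x" "norm f \<le> 1"
proof -
  have "\<bar>z x\<bar> \<le> norm x" for x
    using le[of x] le[of "- x"] by (simp add: linear_neg[OF z])
  then have "bounded_linear z"
    using z by (intro bounded_linear_intro[where K = 1])
      (auto simp: linear_add linear_scale)
  then obtain f where f: "f \<in> dual_space scl" "\<And>x. re (blinfun_apply f x) = z x"
    using extend by blast
  then show thesis
    using norm_le_of_re_le[of f 1] le that by simp
qed

text \<open>The chain from 1 through the real part and the modulus of the value to
  \<open>norm f\<close>, which is at most 1, consists of equalities.\<close>

lemma attains_norm_one:
  assumes "f \<in> dual_space scl" "norm f \<le> 1" "norm y = 1" "1 \<le> re (blinfun_apply f y)"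
  shows "f \<in> dual_sphere scl" and "blinfun_apply f y = 1"
proof -
  have "norm (blinfun_apply f y) \<le> norm f"
    using norm_blinfun[of f y] assms by simp
  moreover have "1 \<le> norm (blinfun_apply f y)"
    using assms(4) re_le_norm order_trans by blast
  ultimately show "f \<in> dual_sphere scl" "blinfun_apply f y = 1"
    using assms re_le_norm[of "blinfun_apply f y"]
    by (auto simp: dual_sphere_def intro!: re_eq_one)
qed

text \<open>Mazur-Orlicz with the norm as both bounds, the lower one on the ray through
  \<open>x\<close>.\<close>

lemma norming_functional:
  assumes "x \<noteq> 0"
  obtains f where "f \<in> dual_sphere scl" "re (blinfun_apply f x) = norm x"
proof -
  interpret sublinear_over_cone norm norm "(\<lambda>s. s *\<^sub>R x) ` {0..}"
    by (rule sublinear_over_ray[OF sublinear_norm])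
  obtain z where z: "linear z" "\<And>x. z x \<le> norm x"
      and ge: "\<And>u. u \<in> (\<lambda>s. s *\<^sub>R x) ` {0..} \<Longrightarrow> norm u \<le> z u"
    by (rule mazur_orlicz) blast
  have "norm x \<le> z x"
    by (rule ge, rule image_eqI[of _ _ 1]) auto
  then have zx: "z x = norm x" using z(2)[of x] by simp
  obtain f where f: "f \<in> dual_space scl" "\<And>x. re (blinfun_apply f x) = z x" "norm f \<le> 1"
    using extend_bound[OF z] by blast
  have "norm x \<le> norm f * norm x"
    using re_apply_le[of f x] f(2) zx by simp
  then have "norm f = 1" using f(3) assms by simp
  then show thesis using that f zx by (auto simp: dual_sphere_def)
qed

section \<open>Strong subdifferentiability and correction of a single functional\<close>

text \<open>The case of a single index of weight 1, to which the general condition reduces.\<close>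

definition functional_correction :: bool where
  "functional_correction \<longleftrightarrow>
     (\<forall>\<epsilon>>0. \<forall>y \<in> sphere (0::'a) 1. \<exists>\<eta>>0. \<forall>f \<in> dual_sphere scl.
        re (blinfun_apply f y) > 1 - \<eta> \<longrightarrow>
        (\<exists>z \<in> dual_sphere scl. blinfun_apply z y = 1 \<and> norm (z - f) < \<epsilon>))"

text \<open>Since \<open>N\<close> is at least 1, \<open>{1}\<close> is an admissible index set.
  Conversely, no term exceeds its weight, so the defect of any one term is at most the total
  defect.\<close>

lemma convex_combination_correction_iff:
  assumes "N \<ge> 1"
  shows "convex_combination_correction scl re N \<longleftrightarrow> functional_correction"
proof
  assume conv: "convex_combination_correction scl re N"
  show functional_correction
    unfolding functional_correction_def
  proof (intro allI impI ballI)
    fix \<epsilon> :: real and y :: 'a assume \<epsilon>: "0 < \<epsilon>" and y: "y \<in> sphere 0 1"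
    have "{1::nat} \<subseteq> {1..N} \<and> {1::nat} \<noteq> {} \<and> (\<forall>j\<in>{1::nat}. (1::real) > 0) \<and>
        (\<Sum>j\<in>{1::nat}. (1::real)) = 1"
      using assms by simp
    from conv[unfolded convex_combination_correction_def, THEN spec, THEN mp, OF \<epsilon>,
        THEN spec[of _ "{1}"], THEN spec[of _ "\<lambda>_. 1"], THEN bspec, OF y, THEN mp, OF this]
    obtain \<eta> where \<eta>: "0 < \<eta>" and cor: "\<And>y' :: nat \<Rightarrow> 'a \<Rightarrow>\<^sub>L 'k. y' 1 \<in> dual_sphere scl \<Longrightarrow>
          re (blinfun_apply (y' 1) y) > 1 - \<eta> \<Longrightarrow>
          \<exists>z' :: nat \<Rightarrow> 'a \<Rightarrow>\<^sub>L 'k. z' 1 \<in> dual_sphere scl \<and> blinfun_apply (z' 1) y = 1 \<and>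
            norm (z' 1 - y' 1) < \<epsilon>"
      by auto
    show "\<exists>\<eta>>0. \<forall>f\<in>dual_sphere scl. re (blinfun_apply f y) > 1 - \<eta> \<longrightarrow>
        (\<exists>z\<in>dual_sphere scl. blinfun_apply z y = 1 \<and> norm (z - f) < \<epsilon>)"
    proof (intro exI[of _ \<eta>] conjI \<eta> ballI impI)
      fix f assume "f \<in> dual_sphere scl" "re (blinfun_apply f y) > 1 - \<eta>"
      then show "\<exists>z\<in>dual_sphere scl. blinfun_apply z y = 1 \<and> norm (z - f) < \<epsilon>"
        using cor[of "\<lambda>_. f"] by blast
    qed
  qed
next
  assume single: functional_correction
  show "convex_combination_correction scl re N"
    unfolding convex_combination_correction_def
  proof (intro allI impI ballI, elim conjE)
    fix \<epsilon> :: real and A :: "nat set" and \<alpha> :: "nat \<Rightarrow> real" and y :: 'a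
    assume \<epsilon>: "0 < \<epsilon>" and y: "y \<in> sphere 0 1" and A: "A \<subseteq> {1..N}" "A \<noteq> {}"
      and \<alpha>: "\<forall>j\<in>A. 0 < \<alpha> j" and sum: "(\<Sum>j\<in>A. \<alpha> j) = 1"
    have fin: "finite A" using A(1) finite_subset by blast
    obtain \<eta> where \<eta>: "0 < \<eta>" and cor: "\<And>f. f \<in> dual_sphere scl \<Longrightarrow>
        re (blinfun_apply f y) > 1 - \<eta> \<Longrightarrow>
        \<exists>z\<in>dual_sphere scl. blinfun_apply z y = 1 \<and> norm (z - f) < \<epsilon>"
      using single \<epsilon> y unfolding functional_correction_def by blast
    \<comment> \<open>With total defect below \<open>\<mu> * \<eta>\<close>, dividing by any weight
      leaves a defect below \<open>\<eta>\<close>.\<close>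
    define \<mu> where "\<mu> = Min (\<alpha> ` A)"
    have \<mu>: "0 < \<mu>" "\<And>j. j \<in> A \<Longrightarrow> \<mu> \<le> \<alpha> j"
      using fin A(2) \<alpha> by (auto simp: \<mu>_def)
    show "\<exists>\<eta>>0. \<forall>y'. (\<forall>j\<in>A. y' j \<in> dual_sphere scl) \<and>
        re (\<Sum>j\<in>A. \<alpha> j *\<^sub>R blinfun_apply (y' j) y) > 1 - \<eta> \<longrightarrow>
        (\<exists>z'. \<forall>j\<in>A. z' j \<in> dual_sphere scl \<and> blinfun_apply (z' j) y = 1 \<and>
           norm (z' j - y' j) < \<epsilon>)"
    proof (intro exI[of _ "\<mu> * \<eta>"] conjI allI impI, goal_cases)
      case 1
      show ?case using \<mu>(1) \<eta> by simp
    next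
      case (2 y')
      then have sph: "\<And>j. j \<in> A \<Longrightarrow> y' j \<in> dual_sphere scl"
        and gt: "re (\<Sum>j\<in>A. \<alpha> j *\<^sub>R blinfun_apply (y' j) y) > 1 - \<mu> * \<eta>" by auto
      have gt': "(\<Sum>j\<in>A. \<alpha> j * re (blinfun_apply (y' j) y)) > 1 - \<mu> * \<eta>"
        using gt by (simp add: linear_sum[OF linear_re] linear_scale[OF linear_re])
      have le1: "re (blinfun_apply (y' j) y) \<le> 1" if "j \<in> A" for j
        using re_apply_le[of "y' j" y] sph[OF that] y by (simp add: dual_sphere_def)
      have "\<exists>z\<in>dual_sphere scl. blinfun_apply z y = 1 \<and> norm (z - y' j) < \<epsilon>" if j: "j \<in> A" for j
      proof (rule cor[OF sph[OF j]])
        \<comment> \<open>All other terms are replaced by their weights, which charges the whole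
          defect to \<open>j\<close>.\<close>
        have "(\<Sum>i\<in>A. \<alpha> i * re (blinfun_apply (y' i) y))
            = \<alpha> j * re (blinfun_apply (y' j) y) + (\<Sum>i\<in>A - {j}. \<alpha> i * re (blinfun_apply (y' i) y))"
          by (rule sum.remove[OF fin j])
        also have "\<dots> \<le> \<alpha> j * re (blinfun_apply (y' j) y) + (\<Sum>i\<in>A - {j}. \<alpha> i * 1)"
          using \<alpha> le1 by (intro add_left_mono sum_mono mult_left_mono) (auto intro: less_imp_le)
        also have "(\<Sum>i\<in>A - {j}. \<alpha> i * 1) = 1 - \<alpha> j"
          using sum.remove[OF fin j, of \<alpha>] sum by simp
        finally have "\<alpha> j * (1 - re (blinfun_apply (y' j) y)) < \<mu> * \<eta>"
          using gt' by (simp add: algebra_simps)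
        also have "\<dots> \<le> \<alpha> j * \<eta>"
          using \<mu>(2)[OF j] \<eta> by simp
        finally show "1 - \<eta> < re (blinfun_apply (y' j) y)"
          using \<alpha> j by simp
      qed
      then have "\<forall>j\<in>A. \<exists>z. z \<in> dual_sphere scl \<and> blinfun_apply z y = 1 \<and> norm (z - y' j) < \<epsilon>"
        by blast
      then show ?case by (rule bchoice)
    qed
  qed
qed

text \<open>The chain is \<open>d h \<le> q t h \<le> re f h \<le> re z h + e / 2 \<le> d h + e /
  2\<close>, with \<open>f\<close> norming \<open>y + t *\<^sub>R h\<close> and \<open>z\<close> its
  correction.\<close>

lemma functional_correction_imp_ssd:
  assumes functional_correction
  shows "strongly_subdifferentiable_norm TYPE('a)"
  unfolding strongly_subdifferentiable_norm_def
proof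
  fix y :: 'a assume y: "y \<in> sphere 0 1"
  then have ny: "norm y = 1" by simp
  define q where "q t h = (norm (y + t *\<^sub>R h) - norm y) / t" for t h
  \<comment> \<open>Difference quotients increase with the step, so the limit can only be their
    infimum.\<close>
  define d where "d h = (INF s\<in>{0<..}. q s h)" for h
  have q_lower: "- norm h \<le> q s h" if "0 < s" for s h
  proof -
    have "norm y \<le> norm (y + s *\<^sub>R h) + s * norm h"
      using norm_triangle_ineq4[of "y + s *\<^sub>R h" "s *\<^sub>R h"] that by simp
    then show ?thesis using that by (simp add: q_def field_simps)
  qed
  have d_le: "d h \<le> q s h" if "0 < s" for s h
    unfolding d_def
    by (rule cINF_lower) (use that q_lower in \<open>auto intro!: bdd_belowI2[where m = "- norm h"]\<close>)
  have "uniform_limit (cball 0 1) q d (at_right 0)"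
  proof (rule uniform_limitI)
    fix e :: real assume e: "0 < e"
    then obtain \<eta> where \<eta>: "0 < \<eta>" and cor: "\<And>f. f \<in> dual_sphere scl \<Longrightarrow>
        re (blinfun_apply f y) > 1 - \<eta> \<Longrightarrow>
        \<exists>z\<in>dual_sphere scl. blinfun_apply z y = 1 \<and> norm (z - f) < e / 2"
      using assms y unfolding functional_correction_def by (metis half_gt_zero)
    \<comment> \<open>\<open>t < 1\<close> keeps \<open>y + t *\<^sub>R h\<close> nonzero;
      \<open>t < \<eta> / 2\<close> makes \<open>1 - 2 * t\<close>, a lower bound for
      \<open>re f y\<close>, exceed \<open>1 - \<eta>\<close>.\<close>
    have close: "dist (q t h) (d h) < e"
      if t: "0 < t" "t < min 1 (\<eta> / 2)" and h: "h \<in> cball 0 1" for t h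
    proof -
      have nh: "norm h \<le> 1" using h by simp
      then have th: "norm (t *\<^sub>R h) \<le> t" using t by (simp add: mult_left_le)
      have low: "1 - t \<le> norm (y + t *\<^sub>R h)"
        using norm_triangle_ineq4[of "y + t *\<^sub>R h" "t *\<^sub>R h"] th ny by simp
      then have "y + t *\<^sub>R h \<noteq> 0" using t by auto
      then obtain f where f: "f \<in> dual_sphere scl"
          and fx: "re (blinfun_apply f (y + t *\<^sub>R h)) = norm (y + t *\<^sub>R h)"
        by (rule norming_functional)
      have nf: "norm f = 1" using f by (simp add: dual_sphere_def)
      have split: "norm (y + t *\<^sub>R h) = re (blinfun_apply f y) + t * re (blinfun_apply f h)"
        using fx linear_add[OF linear_re_apply, of f y "t *\<^sub>R h"]
          linear_scale[OF linear_re_apply, of f t h] by simp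
      have "re (blinfun_apply f h) \<le> 1" "re (blinfun_apply f y) \<le> 1"
        using re_apply_le[of f h] re_apply_le[of f y] nf nh ny by auto
      then have "t * re (blinfun_apply f h) \<le> t" using t by (simp add: mult_left_le)
      then have "re (blinfun_apply f y) > 1 - \<eta>" using split low t by linarith
      then obtain z where z: "z \<in> dual_sphere scl" "blinfun_apply z y = 1" "norm (z - f) < e / 2"
        using cor[OF f] by blast
      have nz: "norm z = 1" using z(1) by (simp add: dual_sphere_def)
      have "re (blinfun_apply (f - z) h) \<le> norm (f - z) * norm h" by (rule re_apply_le)
      also have "\<dots> \<le> norm (f - z)" using nh by (simp add: mult_left_le)
      finally have fz: "re (blinfun_apply f h) \<le> re (blinfun_apply z h) + e / 2"
        using z(3) by (simp add: blinfun.diff_left linear_diff[OF linear_re] norm_minus_commute)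
      have qt: "q t h \<le> re (blinfun_apply f h)"
        using split ny t \<open>re (blinfun_apply f y) \<le> 1\<close> by (simp add: q_def field_simps)
      \<comment> \<open>Attaining its norm at \<open>y\<close>, \<open>z\<close> gives a subgradient
        of the norm there, so its real part at \<open>h\<close> is below every quotient.\<close>
      have "re (blinfun_apply z h) \<le> d h"
        unfolding d_def
      proof (rule cINF_greatest)
        fix s :: real assume s: "s \<in> {0<..}"
        have "1 + s * re (blinfun_apply z h) = re (blinfun_apply z (y + s *\<^sub>R h))"
          using linear_add[OF linear_re_apply, of z y "s *\<^sub>R h"]
            linear_scale[OF linear_re_apply, of z s h] z(2) re_of_real[of 1] by simp
        also have "\<dots> \<le> norm (y + s *\<^sub>R h)"
          using re_apply_le[of z] nz by simp
        finally show "re (blinfun_apply z h) \<le> q s h"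
          using s ny by (simp add: q_def field_simps)
      qed auto
      with fz qt d_le[OF t(1), of h] e show ?thesis by (simp add: dist_real_def)
    qed
    show "\<forall>\<^sub>F t in at_right 0. \<forall>h\<in>cball 0 1. dist (q t h) (d h) < e"
      unfolding eventually_at_right_field
      by (intro exI[of _ "min 1 (\<eta> / 2)"]) (use \<eta> close in auto)
  qed
  then show "\<exists>d. uniform_limit (cball 0 1) (\<lambda>t h. (norm (y + t *\<^sub>R h) - norm y) / t) d (at_right 0)"
    unfolding q_def by blast
qed

lemma ssd_imp_functional_correction:
  assumes "strongly_subdifferentiable_norm TYPE('a)"
  shows functional_correction
  unfolding functional_correction_def
proof (intro allI impI ballI)
  fix \<epsilon> :: real and y :: 'a assume \<epsilon>: "0 < \<epsilon>" and y: "y \<in> sphere 0 1"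
  then have ny: "norm y = 1" by simp
  define q where "q t h = (norm (y + t *\<^sub>R h) - norm y) / t" for t h
  \<comment> \<open>The sandwich only yields distance at most \<open>c\<close>; halving makes the
    final bound strict.\<close>
  define c where "c = \<epsilon> / 2"
  have c: "0 < c" using \<epsilon> by (simp add: c_def)
  obtain d where d: "uniform_limit (cball 0 1) q d (at_right 0)"
    using assms y unfolding strongly_subdifferentiable_norm_def q_def by blast
  have d_le: "d h \<le> q s h" if s: "0 < s" and h: "h \<in> cball 0 1" for s h
  proof (rule tendsto_upperbound[OF tendsto_uniform_limitI[OF d h]])
    show "\<forall>\<^sub>F t in at_right 0. q t h \<le> q s h"
      unfolding eventually_at_right_field q_def
      by (intro exI[of _ s] conjI allI impI norm_difference_quotient_mono) (use s in auto)
  qed simp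
  \<comment> \<open>Uniformity enters only here: a single step \<open>t\<close> serves all
    directions.\<close>
  have "\<forall>\<^sub>F t in at_right 0. 0 < t \<and> (\<forall>h\<in>cball 0 1. dist (q t h) (d h) < c / 2)"
    using uniform_limitD[OF d, of "c / 2"] c eventually_at_right_less[of "0::real"]
    by (auto intro: eventually_conj)
  then obtain t where t: "0 < t" and dist: "\<And>h. h \<in> cball 0 1 \<Longrightarrow> dist (q t h) (d h) < c / 2"
    using eventually_happens' trivial_limit_at_right_real by blast
  show "\<exists>\<eta>>0. \<forall>f\<in>dual_sphere scl. 1 - \<eta> < re (blinfun_apply f y) \<longrightarrow>
      (\<exists>z\<in>dual_sphere scl. blinfun_apply z y = 1 \<and> norm (z - f) < \<epsilon>)"
  \<comment> \<open>Divided by \<open>t\<close>, the defect of \<open>f\<close> at \<open>y\<close>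
    costs at most \<open>c / 2\<close>; uniform closeness costs the other half.\<close>
  proof (intro exI[of _ "t * c / 2"] conjI ballI impI)
    show "0 < t * c / 2" using t c by simp
    fix f assume f: "f \<in> dual_sphere scl" and fy: "1 - t * c / 2 < re (blinfun_apply f y)"
    have nf: "norm f = 1" and fd: "f \<in> dual_space scl"
      using f by (auto simp: dual_sphere_def)
    let ?f = "\<lambda>x. re (blinfun_apply f x)"
    note f_linear = linear_add[OF linear_re_apply] linear_scale[OF linear_re_apply]
    have f_le: "?f x \<le> norm x" for x
      using re_apply_le[of f x] nf by simp
    \<comment> \<open>The estimate at the fixed step \<open>t\<close> passes through
      \<open>d\<close> to every step \<open>s\<close>.\<close>
    have unit: "?f u - c \<le> q s u" if s: "0 < s" and u: "u \<in> cball 0 1" for s u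
    proof -
      have "?f y + t * ?f u \<le> norm (y + t *\<^sub>R u)"
        using f_le[of "y + t *\<^sub>R u"] by (simp add: f_linear)
      then have "t * ?f u \<le> norm (y + t *\<^sub>R u) - 1 + t * c / 2"
        using fy by linarith
      then have "?f u \<le> q t u + c / 2"
        using t ny by (simp add: q_def field_simps)
      also have "\<dots> \<le> d u + c"
        using dist[OF u] by (simp add: dist_real_def abs_if split: if_splits)
      finally show ?thesis using d_le[OF s u] by simp
    qed
    \<comment> \<open>The main case is \<open>unit\<close> for the normalized direction and step
      \<open>norm h / s\<close>, multiplied by \<open>norm h\<close>.\<close>
    have below: "?f h - c * norm h \<le> norm (h + s *\<^sub>R y) - s" if s: "0 \<le> s" for s h
    proof (cases "s = 0 \<or> h = 0")
      case True
      then show ?thesis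
      proof
        assume "s = 0"
        moreover have "0 \<le> c * norm h" using c by simp
        ultimately show ?thesis using f_le[of h] by simp
      next
        assume "h = 0"
        then show ?thesis using s ny f_le[of 0] by simp
      qed
    next
      case False
      then have s: "0 < s" and h: "0 < norm h" using s by auto
      have scaled: "(norm h / s) *\<^sub>R inverse (norm h) *\<^sub>R h = inverse s *\<^sub>R h"
        using h by (simp add: divide_inverse)
      have "?f (inverse (norm h) *\<^sub>R h) - c \<le> q (norm h / s) (inverse (norm h) *\<^sub>R h)"
        using s h by (intro unit) auto
      then have "inverse (norm h) * ?f h - c \<le> (norm (y + inverse s *\<^sub>R h) - 1) / (norm h / s)"
        unfolding q_def ny scaled f_linear by simp
      then have "?f h - c * norm h \<le> s * norm (y + inverse s *\<^sub>R h) - s"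
        using h s by (simp add: field_simps)
      also have "s * norm (y + inverse s *\<^sub>R h) = norm (s *\<^sub>R (y + inverse s *\<^sub>R h))"
        using s by simp
      also have "s *\<^sub>R (y + inverse s *\<^sub>R h) = h + s *\<^sub>R y"
        using s by (simp add: algebra_simps)
      finally show ?thesis .
    qed
    let ?ray = "(\<lambda>s. s *\<^sub>R y) ` {0..}"
    interpret ray: sublinear_over_cone norm norm ?ray
      by (rule sublinear_over_ray[OF sublinear_norm])
    \<comment> \<open>This envelope is the directional derivative of the norm at \<open>y\<close>, since
      \<open>(norm (y + t *\<^sub>R h) - 1) / t = norm (h + s *\<^sub>R y) - s\<close> for \<open>s = 1 / t\<close>.\<close>
    let ?D = "envelope norm ?ray norm"
    interpret sandwich: sublinear_over_cone ?D "\<lambda>x. ?f x - c * norm x" UNIV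
    proof
      show "sublinear ?D" by (rule ray.sublinear_envelope)
      show "convex_cone (UNIV :: 'a set)" by (simp add: convex_cone_iff)
      show "(?f x - c * norm x) + (?f x' - c * norm x') \<le> ?f (x + x') - c * norm (x + x')" for x x'
        using mult_left_mono[OF norm_triangle_ineq[of x x'], of c] c
        by (simp add: f_linear algebra_simps)
      show "?f (r *\<^sub>R x) - c * norm (r *\<^sub>R x) = r * (?f x - c * norm x)" if "0 \<le> r" for r x
        using that by (simp add: f_linear algebra_simps)
      show "?f x - c * norm x \<le> ?D x" for x
        unfolding envelope_def
        by (rule cINF_greatest) (use below ny in auto)
    qed
    obtain z where z: "linear z" "\<And>x. z x \<le> ?D x" "\<And>x. ?f x - c * norm x \<le> z x"
      by (rule sandwich.mazur_orlicz) blast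
    have z_le: "z x \<le> norm x" for x
      using z(2) ray.envelope_le order_trans by blast
    obtain F where F: "F \<in> dual_space scl" "\<And>x. re (blinfun_apply F x) = z x" "norm F \<le> 1"
      using extend_bound[OF z(1) z_le] by blast
    have "y \<in> ?ray" by (rule image_eqI[of _ _ 1]) auto
    \<comment> \<open>The right side is -1, so domination by \<open>?D\<close>, unlike domination by
      the norm alone, forces \<open>z\<close> to attain 1 at \<open>y\<close>.\<close>
    then have "z (- y) \<le> norm (- y + y) - norm y"
      using z(2) ray.envelope_lower order_trans by blast
    then have "1 \<le> re (blinfun_apply F y)"
      by (simp add: F(2) linear_neg[OF z(1)] ny)
    note Fy = attains_norm_one[OF F(1,3) ny this]
    have "norm (f - F) \<le> c"
    proof (rule norm_le_of_re_le[OF dual_space_diff[OF fd F(1)]])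
      show "re (blinfun_apply (f - F) x) \<le> c * norm x" for x
        using z(3)[of x] by (simp add: blinfun.diff_left linear_diff[OF linear_re] F(2))
    qed (use c in simp)
    then have "norm (F - f) < \<epsilon>"
      using \<epsilon> by (simp add: norm_minus_commute c_def)
    with Fy show "\<exists>z\<in>dual_sphere scl. blinfun_apply z y = 1 \<and> norm (z - f) < \<epsilon>" by blast
  qed
qed

theorem ssd_iff_convex_combination_correction:
  assumes "N \<ge> 1"
  shows "strongly_subdifferentiable_norm TYPE('a) \<longleftrightarrow> convex_combination_correction scl re N"
  using convex_combination_correction_iff[OF assms] functional_correction_imp_ssd
    ssd_imp_functional_correction by blast

end

section \<open>Real and complex scalars\<close>

lemma scalar_real_part_real:
  "scalar_real_part (scaleR :: real \<Rightarrow> 'a::real_normed_vector \<Rightarrow> 'a) (\<lambda>r. r)"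
proof -
  interpret normed_space_over "scaleR :: real \<Rightarrow> 'a \<Rightarrow> 'a"
    by (rule normed_space_over_scaleR)
  show ?thesis
  proof
    show "\<exists>u. norm u = 1 \<and> u * c = of_real (norm c)" for c :: real
      by (rule exI[of _ "if c < 0 then - 1 else 1"]) auto
    show "\<exists>f\<in>dual_space scaleR. \<forall>x. blinfun_apply f x = z x" if "bounded_linear z"
      for z :: "'a \<Rightarrow> real"
      using that
      by (intro bexI[of _ "Blinfun z"])
        (auto simp: dual_space_def bounded_linear_Blinfun_apply linear_simps)
  qed auto
qed

text \<open>A complex functional is determined by its real part \<open>z\<close> through
  \<open>f x = z x - \<i> * z (\<i> x)\<close>.\<close>

lemma scalar_real_part_complex:
  assumes "normed_space_over (scl :: complex \<Rightarrow> 'a::real_normed_vector \<Rightarrow> 'a)"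
  shows "scalar_real_part scl Re"
proof -
  interpret normed_space_over scl by fact
  show ?thesis
  proof
    show "c = 1" if "cmod c \<le> 1" "Re c = 1" for c
    proof -
      have "(Re c)\<^sup>2 + (Im c)\<^sup>2 \<le> 1"
        using that(1) by (simp add: cmod_def)
      then show ?thesis using that(2) by (simp add: complex_eq_iff)
    qed
    show "\<exists>u. norm u = 1 \<and> u * c = of_real (norm c)" for c :: complex
    proof (cases "c = 0")
      case False
      then show ?thesis
        by (intro exI[of _ "of_real (norm c) / c"]) (simp add: norm_divide)
    qed (auto intro: exI[of _ 1])
    show "\<exists>f\<in>dual_space scl. \<forall>x. Re (blinfun_apply f x) = z x" if z: "bounded_linear z"
      for z :: "'a \<Rightarrow> real"
    proof -
      have scl_R: "scl c (r *\<^sub>R x) = r *\<^sub>R scl c x" for c r x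
        by (simp flip: scale_of_real add: mult.commute)
      let ?f = "\<lambda>x. Complex (z x) (- z (scl \<i> x))"
      have i: "bounded_linear (scl \<i>)"
        by (rule bounded_linear_intro[where K = 1]) (auto simp: scale_right_distrib scl_R norm_scale)
      have "bounded_linear (\<lambda>x. of_real (z x) - \<i> * of_real (z (scl \<i> x)))"
        by (intro bounded_linear_sub bounded_linear_const_mult
            bounded_linear_compose[OF bounded_linear_of_real] bounded_linear_compose[OF z i] z)
      then have "bounded_linear ?f"
        by (simp add: Complex_eq)
      moreover have "?f (scl c x) = c * ?f x" for c x
      proof -
        \<comment> \<open>This reduces complex homogeneity to real linearity and the identity
          \<open>ii\<close>.\<close>
        have c: "scl c x = Re c *\<^sub>R x + Im c *\<^sub>R scl \<i> x"
          by (subst complex_eq[of c]) (simp add: scale_left_distrib mult.commute[of \<i>]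
              scale_of_real flip: scale_scale)
        have ii: "scl \<i> (scl \<i> x) = - x"
          using scale_scale[of \<i> \<i> x] by (simp add: scale_minus_left)
        show ?thesis
          unfolding c
          by (simp add: complex_eq_iff linear_simps[OF z] linear_simps[OF i] scl_R ii algebra_simps)
      qed
      ultimately show ?thesis
        by (intro bexI[of _ "Blinfun ?f"]) (auto simp: dual_space_def bounded_linear_Blinfun_apply)
    qed
  qed (auto simp: complex_Re_le_cmod intro!: linearI)
qed

text \<open>Strong subdifferentiability involves only the real structure, so the same left-hand side
  serves both fields.\<close>

theorem proposition3p2:
  fixes N :: nat and scaleC :: "complex \<Rightarrow> 'a::banach \<Rightarrow> 'a"
  assumes "N \<ge> 1"
  shows "(strongly_subdifferentiable_norm TYPE('a) \<longleftrightarrow>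
            convex_combination_correction (scaleR :: real \<Rightarrow> 'a \<Rightarrow> 'a) (\<lambda>r. r) N) \<and>
         (normed_space_over scaleC \<longrightarrow>
            (strongly_subdifferentiable_norm TYPE('a) \<longleftrightarrow>
             convex_combination_correction scaleC Re N))"
  by (intro conjI impI scalar_real_part.ssd_iff_convex_combination_correction
      scalar_real_part_real scalar_real_part_complex assms)

end
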